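(* Let $\mathcal C$ be a regular orthogonal representation of an orthogonal matroid $M=(E\cup E^*,\mathcal B)$. Then the order of the Jacobian group $\mathrm{Jac}(\mathcal C)$ equals the number $|\mathcal B|$ of bases of $M$.
   Context: $E$ is a finite set with $|E|=n$, $E^*=\{e^*:e\in E\}$ a disjoint copy, $(e^* )^*=e$. A transversal is an $n$-element subset of $E\cup E^*$ containing no pair $\{e,e^*\}$; a subtransversal is a subset of a transversal. An orthogonal matroid on $E\cup E^*$ is a pair $M=(E\cup E^*,\mathcal B)$ with $\mathcal B$ a nonempty set of transversals (bases) such that for all $B,B'\in\mathcal B$ and $e\in B\setminus B'$ there is $f\neq e$ in $B\setminus B'$ with $B\triangle\{e,e^*,f,f^*\}\in\mathcal B$. A circuit is a minimal subtransversal not contained in any basis. For $\mathbf C\in\mathbb Z^{E\cup E^*}$ let $\mathbf C^*(e)=\mathbf C(e^* )$. A regular orthogonal representation of $M$ is a set $\mathcal C$ of $(0,\pm1)$-vectors in $\mathbb Z^{E\cup E^*}$ with $\mathcal C=-\mathcal C$, with $\{\mathrm{supp}(\mathbf C):\mathbf C\in\mathcal C\}$ equal to the set of circuits of $M$, and with $\sum_{e\in E\cup E^*}\mathbf C(e)\mathbf D^*(e)=0$ for all $\mathbf C,\mathbf D\in\mathcal C$. Let $\pi:\mathbb Q^{E\cup E^*}\to\mathbb Q^E$, $\pi(\mathbf v)(e)=\mathbf v(e)+\mathbf v(e^* )$, and let $\langle\pi(\mathcal C)\rangle$ be the subgroup of $\mathbb Z^E$ generated by $\{\pi(\mathbf C):\mathbf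 C\in\mathcal C\}$. The Jacobian group is $\mathrm{Jac}(\mathcal C):=\mathbb Z^E/\langle\pi(\mathcal C)\rangle$. *)

theory Defs
  imports
    "HOL-Algebra.Elementary_Groups"
    "HOL-Algebra.Product_Groups"
    "HOL-Algebra.Generated_Groups"
begin

text \<open>
  The set \<open>E \<union> E\<^sup>*\<close> is encoded as the disjoint sum \<open>E <+> E\<close>: an element
  \<open>e \<in> E\<close> is \<open>Inl e\<close> and its copy \<open>e\<^sup>*\<close> is \<open>Inr e\<close>.
\<close>

definition ground :: "'a set \<Rightarrow> ('a + 'a) set" where
  "ground E = E <+> E"

definition star :: "'a + 'a \<Rightarrow> 'a + 'a" where
  "star x = (case x of Inl e \<Rightarrow> Inr e | Inr e \<Rightarrow> Inl e)"

definition transversal :: "'a set \<Rightarrow> ('a + 'a) set \<Rightarrow> bool" where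
  "transversal E T \<longleftrightarrow>
     T \<subseteq> ground E \<and> card T = card E \<and> \<not> (\<exists>e \<in> ground E. {e, star e} \<subseteq> T)"

definition subtransversal :: "'a set \<Rightarrow> ('a + 'a) set \<Rightarrow> bool" where
  "subtransversal E S \<longleftrightarrow> (\<exists>T. transversal E T \<and> S \<subseteq> T)"

definition orthogonal_matroid :: "'a set \<Rightarrow> ('a + 'a) set set \<Rightarrow> bool" where
  "orthogonal_matroid E \<B> \<longleftrightarrow>
     finite E \<and> \<B> \<noteq> {} \<and> (\<forall>B \<in> \<B>. transversal E B) \<and>
     (\<forall>B \<in> \<B>. \<forall>B' \<in> \<B>. \<forall>e \<in> B - B'. \<exists>f \<in> B - B'.
        f \<noteq> e \<and> sym_diff B {e, star e, f, star f} \<in> \<B>)"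

definition circuits :: "'a set \<Rightarrow> ('a + 'a) set set \<Rightarrow> ('a + 'a) set set" where
  "circuits E \<B> =
     (let dependent = (\<lambda>S. subtransversal E S \<and> \<not> (\<exists>B \<in> \<B>. S \<subseteq> B))
      in {S. dependent S \<and> \<not> (\<exists>S'. S' \<subset> S \<and> dependent S')})"

text \<open>
  A vector in \<open>\<int>\<^sup>I\<close> is an extensional function, i.e. one that is \<open>undefined\<close> outside \<open>I\<close>.
  Supports, negatives and projections therefore have to be restricted to the index set.
\<close>

definition int_vectors :: "'i set \<Rightarrow> ('i \<Rightarrow> int) monoid" where
  "int_vectors I = product_group I (\<lambda>_. integer_group)"

definition supp :: "'a set \<Rightarrow> ('a + 'a \<Rightarrow> int) \<Rightarrow> ('a + 'a) set" where
  "supp E C = {x \<in> ground E. C x \<noteq> 0}"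

definition dual_vector :: "('a + 'a \<Rightarrow> int) \<Rightarrow> ('a + 'a \<Rightarrow> int)" where
  "dual_vector C = (\<lambda>x. C (star x))"

definition regular_orthogonal_representation ::
    "'a set \<Rightarrow> ('a + 'a) set set \<Rightarrow> ('a + 'a \<Rightarrow> int) set \<Rightarrow> bool" where
  "regular_orthogonal_representation E \<B> \<C> \<longleftrightarrow>
     \<C> \<subseteq> carrier (int_vectors (ground E)) \<and>
     (\<forall>C \<in> \<C>. \<forall>x \<in> ground E. C x \<in> {0, 1, -1}) \<and>
     \<C> = (\<lambda>C. \<lambda>x \<in> ground E. - C x) ` \<C> \<and>
     supp E ` \<C> = circuits E \<B> \<and>
     (\<forall>C \<in> \<C>. \<forall>D \<in> \<C>. (\<Sum>x \<in> ground E. C x * dual_vector D x) = 0)"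

definition proj :: "'a set \<Rightarrow> ('a + 'a \<Rightarrow> int) \<Rightarrow> ('a \<Rightarrow> int)" where
  "proj E v = (\<lambda>e \<in> E. v (Inl e) + v (star (Inl e)))"

definition Jac :: "'a set \<Rightarrow> ('a + 'a \<Rightarrow> int) set \<Rightarrow> ('a \<Rightarrow> int) set monoid" where
  "Jac E \<C> = int_vectors E Mod generate (int_vectors E) (proj E ` \<C>)"

end

theory Submission
  imports Defs "Jordan_Normal_Form.Char_Poly"
begin

text \<open>
  Fix a basis \<open>B\<close>, write \<open>b\<^sub>e\<close> for the element of \<open>B\<close> over \<open>e\<close>, and let \<open>C\<^sub>e\<close> be the signed
  fundamental circuit with \<open>C\<^sub>e(b\<^sub>e\<^sup>*) = 1\<close>. Orthogonality makes the matrix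
  \<open>K(f, e) = C\<^sub>e(b\<^sub>f)\<close> skew-symmetric and shows that every \<open>D \<in> \<C>\<close> equals
  \<open>\<Sum>\<^sub>e D(b\<^sub>e\<^sup>*) C\<^sub>e\<close>. Hence the lattice of projected circuits is \<open>(1 + K) \<int>\<^sup>n\<close>, whose index
  is \<open>\<bar>det (1 + K)\<bar>\<close>, and \<open>det (1 + K)\<close> is the sum of all principal minors \<open>det K[S]\<close>.
  Let \<open>B\<^sub>S\<close> be \<open>B\<close> with \<open>b\<^sub>e\<close> exchanged for \<open>b\<^sub>e\<^sup>*\<close> for all \<open>e \<in> S\<close>. If \<open>B\<^sub>S\<close> is not a basis,
  a circuit inside it gives a kernel vector of \<open>K[S]\<close>. If it is a basis, its fundamental
  circuits give an integral inverse of \<open>K[S]\<close>, so the minor is \<open>\<plusminus>1\<close>, and it is nonnegative by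
  skew-symmetry. The sum therefore counts the bases.
\<close>

text \<open>Otherwise \<open>order\<close> would be the multiplicity of a polynomial root.\<close>

hide_const (open) Polynomial.order

section \<open>The index of the column lattice of an integer matrix\<close>

text \<open>Representatives for the cosets of the column lattice of \<open>A\<close>. With them the
  index can be computed by vector arithmetic alone, and quotient groups enter only at the very
  end.\<close>

definition residue_system :: "int mat \<Rightarrow> int vec set \<Rightarrow> bool" where
  "residue_system A R \<longleftrightarrow> finite R \<and> R \<subseteq> carrier_vec (dim_row A) \<and>
     (\<forall>v \<in> carrier_vec (dim_row A). \<exists>!r. r \<in> R \<and> (\<exists>u \<in> carrier_vec (dim_col A). v = r + A *\<^sub>v u))"

text \<open>Multiplication by \<open>U\<close> is an automorphism of Z^n that carries the lattice of
  \<open>A\<close> onto the lattice of \<open>U * A\<close>, hence representatives to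
  representatives.\<close>

lemma residue_system_unimodular:
  assumes A: "A \<in> carrier_mat n n" and U: "U \<in> carrier_mat n n" and V: "V \<in> carrier_mat n n"
    and UV: "U * V = 1\<^sub>m n" and VU: "V * U = 1\<^sub>m n"
    and R: "residue_system A R"
  shows "residue_system (U * A) ((*\<^sub>v) U ` R)" and "card ((*\<^sub>v) U ` R) = card R"
proof -
  have RC: "R \<subseteq> carrier_vec n" and fin: "finite R" using R A unfolding residue_system_def by auto
  have VUv: "V *\<^sub>v (U *\<^sub>v v) = v" and UVv: "U *\<^sub>v (V *\<^sub>v v) = v" if "v \<in> carrier_vec n" for v
    using that U V UV VU by (simp_all flip: assoc_mult_mat_vec)
  have inj: "inj_on ((*\<^sub>v) U) R"
    by (rule inj_on_inverseI[of _ "(*\<^sub>v) V"]) (use RC VUv in auto)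
  show "card ((*\<^sub>v) U ` R) = card R" using inj by (rule card_image)
  have eq: "v = U *\<^sub>v r + (U * A) *\<^sub>v u \<longleftrightarrow> V *\<^sub>v v = r + A *\<^sub>v u"
    if "v \<in> carrier_vec n" "r \<in> carrier_vec n" "u \<in> carrier_vec n" for v r u
  proof -
    have "U *\<^sub>v r + (U * A) *\<^sub>v u = U *\<^sub>v (r + A *\<^sub>v u)"
      using that U A by (simp add: mult_add_distrib_mat_vec[of _ n n])
    moreover have "r + A *\<^sub>v u \<in> carrier_vec n" using that A by auto
    ultimately show ?thesis using VUv UVv that by metis
  qed
  have "\<exists>!s. s \<in> (*\<^sub>v) U ` R \<and> (\<exists>u \<in> carrier_vec n. v = s + (U * A) *\<^sub>v u)"
    if v: "v \<in> carrier_vec n" for v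
  proof -
    have "V *\<^sub>v v \<in> carrier_vec n" using V v by auto
    then have "\<exists>!r. r \<in> R \<and> (\<exists>u \<in> carrier_vec n. V *\<^sub>v v = r + A *\<^sub>v u)"
      using R A unfolding residue_system_def by auto
    then obtain r where r: "r \<in> R" "\<exists>u \<in> carrier_vec n. V *\<^sub>v v = r + A *\<^sub>v u"
      and uniq: "\<And>r'. r' \<in> R \<Longrightarrow> \<exists>u \<in> carrier_vec n. V *\<^sub>v v = r' + A *\<^sub>v u \<Longrightarrow> r' = r" by blast
    show ?thesis
    proof (rule ex1I[of _ "U *\<^sub>v r"])
      show "U *\<^sub>v r \<in> (*\<^sub>v) U ` R \<and> (\<exists>u \<in> carrier_vec n. v = U *\<^sub>v r + (U * A) *\<^sub>v u)"
        using r eq[OF v] RC by blast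
    next
      fix s assume "s \<in> (*\<^sub>v) U ` R \<and> (\<exists>u \<in> carrier_vec n. v = s + (U * A) *\<^sub>v u)"
      then obtain r' where "s = U *\<^sub>v r'" "r' \<in> R" "\<exists>u \<in> carrier_vec n. v = U *\<^sub>v r' + (U * A) *\<^sub>v u"
        by auto
      then show "s = U *\<^sub>v r" using uniq[of r'] eq[OF v] RC by blast
    qed
  qed
  moreover have "(*\<^sub>v) U ` R \<subseteq> carrier_vec n" using U RC by auto
  ultimately show "residue_system (U * A) ((*\<^sub>v) U ` R)"
    unfolding residue_system_def using fin U A by auto
qed

lemma vec_split_first:
  assumes "v \<in> carrier_vec (Suc n)"
  obtains a x where "x \<in> carrier_vec n" "v = vCons a x"
  using assms by (metis Suc_inject carrier_vec_dim_vec dim_vec_vCons vec_cases carrier_vecD old.nat.distinct(1) dim_vec)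

lemma vCons_add: "dim_vec y = dim_vec x \<Longrightarrow> vCons a x + vCons b y = vCons (a + b) (x + y)"
  by (intro eq_vecI) (auto simp: vec_index_vCons)

lemma vec_add_left_imp_eq:
  fixes x y z :: "'a :: group_add vec"
  assumes "x \<in> carrier_vec n" "y \<in> carrier_vec n" "z \<in> carrier_vec n" "x + y = x + z"
  shows "y = z"
proof (rule eq_vecI)
  fix i assume "i < dim_vec z"
  moreover have "(x + y) $ i = (x + z) $ i" using assms by simp
  ultimately show "y $ i = z $ i" using assms(1-3) by simp
qed (use assms in auto)

text \<open>By \<open>Av\<close>, \<open>A\<close> is block upper triangular with pivot
  \<open>d\<close>, top row \<open>w\<close> and lower block \<open>D\<close>. Reducing the tail
  modulo \<open>D\<close> fixes the tail of the lattice coefficient, because \<open>D\<close> is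
  injective; after that the head can change only by multiples of \<open>d\<close>.\<close>

lemma residue_system_block:
  fixes d :: int
  assumes D: "D \<in> carrier_mat n n" and w: "w \<in> carrier_vec n" and d: "d \<noteq> 0" and det: "det D \<noteq> 0"
    and R: "residue_system D R"
    and A: "A \<in> carrier_mat (Suc n) (Suc n)"
    and Av: "\<And>a x. x \<in> carrier_vec n \<Longrightarrow> A *\<^sub>v vCons a x = vCons (d * a + w \<bullet> x) (D *\<^sub>v x)"
  shows "residue_system A ((\<lambda>(a, x). vCons a x) ` ({0..<\<bar>d\<bar>} \<times> R))"
    and "card ((\<lambda>(a, x). vCons a x) ` ({0..<\<bar>d\<bar>} \<times> R)) = nat \<bar>d\<bar> * card R"
proof -
  let ?R = "(\<lambda>(a, x). vCons a x) ` ({0..<\<bar>d\<bar>} \<times> R)"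
  have RC: "R \<subseteq> carrier_vec n" and fin: "finite R" using R D unfolding residue_system_def by auto
  have "inj_on (\<lambda>(a, x). vCons a x) ({0..<\<bar>d\<bar>} \<times> R)" by (auto simp: inj_on_def)
  then show "card ?R = nat \<bar>d\<bar> * card R" by (simp add: card_image card_cartesian_product)
  \<comment> \<open>Two preimages of one tail would shift the head by different values of
    \<open>w \<bullet> u\<close>, so uniqueness of the representative rests on this.\<close>
  have injD: "u = u'" if u: "u \<in> carrier_vec n" "u' \<in> carrier_vec n" and "D *\<^sub>v u = D *\<^sub>v u'" for u u'
  proof -
    have "D *\<^sub>v (u - u') = 0\<^sub>v n" using that D by (simp add: mult_minus_distrib_mat_vec[of _ n n])
    then have "u - u' = 0\<^sub>v n" using det_0_iff_vec_prod_zero[OF D] det u by (metis minus_carrier_vec)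
    then show "u = u'" using u
      by (metis (no_types, lifting) carrier_vecD eq_vecI index_minus_vec(1) index_zero_vec(1) right_minus_eq)
  qed
  have "\<exists>!s. s \<in> ?R \<and> (\<exists>u \<in> carrier_vec (Suc n). v = s + A *\<^sub>v u)" if v: "v \<in> carrier_vec (Suc n)" for v
  proof -
    obtain a x where x: "x \<in> carrier_vec n" and vx: "v = vCons a x" using v by (rule vec_split_first)
    have "\<exists>!r. r \<in> R \<and> (\<exists>u \<in> carrier_vec n. x = r + D *\<^sub>v u)"
      using R D x unfolding residue_system_def by auto
    then obtain r u where r: "r \<in> R" and u: "u \<in> carrier_vec n" and xr: "x = r + D *\<^sub>v u"
      and uniq: "\<And>r'. r' \<in> R \<Longrightarrow> \<exists>u \<in> carrier_vec n. x = r' + D *\<^sub>v u \<Longrightarrow> r' = r" by blast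
    \<comment> \<open>Once \<open>u\<close> has absorbed the tail, \<open>a - w \<bullet> u\<close>
      is what remains of the head, and only its class modulo \<open>d\<close> matters.\<close>
    define \<rho> where "\<rho> = (a - w \<bullet> u) mod \<bar>d\<bar>"
    obtain k where k: "a - w \<bullet> u = \<rho> + d * k"
    proof -
      have "d dvd (a - w \<bullet> u - \<rho>)" unfolding \<rho>_def
        by (metis abs_dvd_iff dvd_minus_mod)
      then show ?thesis using that by (metis dvdE diff_add_cancel add.commute)
    qed
    have \<rho>: "\<rho> \<in> {0..<\<bar>d\<bar>}" using d by (simp add: \<rho>_def)
    show ?thesis
    proof (rule ex1I[of _ "vCons \<rho> r"], intro conjI bexI[of _ "vCons k u"])
      show "vCons \<rho> r \<in> ?R" using \<rho> r by auto
      show "v = vCons \<rho> r + A *\<^sub>v vCons k u" using u k xr r RC D by (auto simp: Av vx vCons_add)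
      show "vCons k u \<in> carrier_vec (Suc n)" using u by simp
    next
      fix s assume "s \<in> ?R \<and> (\<exists>u \<in> carrier_vec (Suc n). v = s + A *\<^sub>v u)"
      then obtain \<rho>' r' u1 where s: "s = vCons \<rho>' r'" "\<rho>' \<in> {0..<\<bar>d\<bar>}" "r' \<in> R"
        and u1: "u1 \<in> carrier_vec (Suc n)" "v = s + A *\<^sub>v u1" by auto
      obtain k' u' where u': "u' \<in> carrier_vec n" "u1 = vCons k' u'" using u1(1) by (rule vec_split_first)
      have e: "a = \<rho>' + (d * k' + w \<bullet> u')" "x = r' + D *\<^sub>v u'"
        using u1(2) u' s(3) RC D by (auto simp: Av vx s(1) vCons_add)
      then have r': "r' = r" using uniq s(3) u' by blast
      have "r + D *\<^sub>v u' = r + D *\<^sub>v u" using e(2) xr r' by metis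
      moreover have "r \<in> carrier_vec n" "D *\<^sub>v u' \<in> carrier_vec n" "D *\<^sub>v u \<in> carrier_vec n"
        using r RC D u u'(1) by auto
      ultimately have "D *\<^sub>v u' = D *\<^sub>v u" by (blast intro: vec_add_left_imp_eq)
      then have "u' = u" using injD u u'(1) by blast
      then have "a - w \<bullet> u = \<rho>' + d * k'" using e by simp
      then have "\<rho> = \<rho>' mod \<bar>d\<bar>" unfolding \<rho>_def
        by (metis mod_mult_self2 abs_mult_sgn mult.assoc mult.commute mult_sgn_abs)
      then show "s = vCons \<rho> r" using s r' by simp
    qed
  qed
  moreover have "?R \<subseteq> carrier_vec (Suc n)" using RC by auto
  ultimately show "residue_system A ?R" unfolding residue_system_def using fin A by auto
qed

text \<open>Euclid's algorithm by row operations clears the first column below the pivot, and the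
  block lemma then splits off one dimension. A triangular shape is enough, so no column operations
  occur.\<close>

lemma exists_residue_system:
  assumes "A \<in> carrier_mat n n" and "det A \<noteq> 0"
  shows "\<exists>R. residue_system A R \<and> int (card R) = \<bar>det A\<bar>"
  using assms
proof (induction n arbitrary: A)
  case 0
  have C: "carrier_vec 0 = {0\<^sub>v 0 :: int vec}" by (auto intro!: eq_vecI)
  have "A *\<^sub>v 0\<^sub>v 0 = 0\<^sub>v 0" "0\<^sub>v 0 + 0\<^sub>v 0 = (0\<^sub>v 0 :: int vec)" using 0 by (auto intro!: eq_vecI)
  then have "residue_system A {0\<^sub>v 0}" using 0(1) C unfolding residue_system_def by auto
  moreover have "det A = 1" using 0 by simp
  ultimately show ?case by (intro exI[of _ "{0\<^sub>v 0}"]) simp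
next
  case (Suc n)
  let ?N = "Suc n"
  have IH: "\<And>D. D \<in> carrier_mat n n \<Longrightarrow> det D \<noteq> 0 \<Longrightarrow> \<exists>R. residue_system D R \<and> int (card R) = \<bar>det D\<bar>"
    using Suc.IH by blast
  \<comment> \<open>Weighting the pivot less than the other entries makes moving a nonzero entry to the pivot a decrease.\<close>
  define m where "m A = nat (\<bar>A $$ (0, 0)\<bar> + 2 * (\<Sum>i\<in>{1..<?N}. \<bar>A $$ (i, 0)\<bar>))" for A :: "int mat"
  have m_less: "m A' < m A"
    if i: "i \<in> {1..<?N}" and eq: "\<And>j. j \<in> {1..<?N} \<Longrightarrow> j \<noteq> i \<Longrightarrow> A' $$ (j, 0) = A $$ (j, 0)"
    and less: "\<bar>A' $$ (0, 0)\<bar> + 2 * \<bar>A' $$ (i, 0)\<bar> < \<bar>A $$ (0, 0)\<bar> + 2 * \<bar>A $$ (i, 0)\<bar>" for A A' i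
  proof -
    let ?s = "\<lambda>A :: int mat. \<Sum>j\<in>{1..<?N}. \<bar>A $$ (j, 0)\<bar>"
    have split: "?s B = \<bar>B $$ (i, 0)\<bar> + (\<Sum>j\<in>{1..<?N} - {i}. \<bar>B $$ (j, 0)\<bar>)" for B :: "int mat"
      by (rule sum.remove[OF _ i]) simp
    have "(\<Sum>j\<in>{1..<?N} - {i}. \<bar>A' $$ (j, 0)\<bar>) = (\<Sum>j\<in>{1..<?N} - {i}. \<bar>A $$ (j, 0)\<bar>)"
      by (rule sum.cong) (use eq in auto)
    then have lt: "\<bar>A' $$ (0, 0)\<bar> + 2 * ?s A' < \<bar>A $$ (0, 0)\<bar> + 2 * ?s A"
      using less split[of A] split[of A'] by linarith
    have "0 \<le> ?s A'" by (rule sum_nonneg) simp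
    with lt show ?thesis unfolding m_def by (intro iffD2[OF nat_mono_iff]) linarith+
  qed
  show ?case using Suc.prems
  proof (induction "m A" arbitrary: A rule: less_induct)
    case less
    note A = less.prems(1)
    \<comment> \<open>One row operation \<open>V\<close> with inverse \<open>U\<close>: the inner
      induction serves \<open>V * A\<close>, the absolute determinant is unchanged, and the
      representatives are moved back by \<open>U\<close>.\<close>
    have step: "\<exists>R. residue_system A R \<and> int (card R) = \<bar>det A\<bar>"
      if U: "U \<in> carrier_mat ?N ?N" and V: "V \<in> carrier_mat ?N ?N" and UV: "U * V = 1\<^sub>m ?N" "V * U = 1\<^sub>m ?N"
        and m: "m (V * A) < m A" for U V
    proof -
      have VA: "V * A \<in> carrier_mat ?N ?N" using V A by simp
      have UVA: "U * (V * A) = A" using assoc_mult_mat[OF U V A] UV A by simp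
      have "det U * det V = 1" using det_mult[OF U V] UV by simp
      then have V1: "\<bar>det V\<bar> = 1" by (metis abs_zmult_eq_1 mult.commute abs_one)
      then have "det (V * A) \<noteq> 0" "\<bar>det (V * A)\<bar> = \<bar>det A\<bar>"
        using det_mult[OF V A] less.prems(2) by (auto simp: abs_mult)
      then obtain R where R: "residue_system (V * A) R" "int (card R) = \<bar>det A\<bar>"
        using less.hyps[OF m VA] by auto
      show ?thesis
        using residue_system_unimodular[OF VA U V UV R(1)] R(2) unfolding UVA by metis
    qed
    show ?case
    proof (cases "\<exists>i \<in> {1..<?N}. A $$ (i, 0) \<noteq> 0")
      case True
      then obtain i where i: "i \<in> {1..<?N}" "A $$ (i, 0) \<noteq> 0" by blast
      have addrow_step: "\<exists>R. residue_system A R \<and> int (card R) = \<bar>det A\<bar>"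
        if "k < ?N" "l < ?N" "k \<noteq> l" "m (addrow a k l A) < m A" for a k l
        using that A addrow_mat[OF A, of l a k] addrow_mat_inv[of k ?N l a] addrow_mat_inv[of k ?N l "-a"]
        by (intro step[of "addrow_mat ?N (-a) k l" "addrow_mat ?N a k l"]) auto
      let ?x = "A $$ (0, 0)" and ?y = "A $$ (i, 0)"
      \<comment> \<open>The sign that makes the added entry work against the other one: for nonzero
        entries the sum has absolute value equal to the difference of the two absolute
        values.\<close>
      define \<epsilon> where "\<epsilon> = - sgn ?x * sgn ?y"
      consider "?x = 0" | "?x \<noteq> 0" "\<bar>?x\<bar> \<le> \<bar>?y\<bar>" | "?x \<noteq> 0" "\<bar>?y\<bar> < \<bar>?x\<bar>" by linarith
      then show ?thesis
      proof cases
        case 1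
        have "m (swaprows 0 i A) < m A" by (rule m_less[OF i(1)]) (use i A 1 in auto)
        then show ?thesis using i A swaprows_mat[OF A, of 0 i] swaprows_mat_inv[of 0 ?N i]
          by (intro step[of "swaprows_mat ?N 0 i" "swaprows_mat ?N 0 i"]) auto
      next
        case 2
        then have "\<bar>?y + \<epsilon> * ?x\<bar> < \<bar>?y\<bar>" using i unfolding \<epsilon>_def by (auto simp: sgn_if)
        then have "m (addrow \<epsilon> i 0 A) < m A" by (intro m_less[OF i(1)]) (use i A in \<open>auto simp: algebra_simps\<close>)
        then show ?thesis using i by (intro addrow_step[of i 0 \<epsilon>]) auto
      next
        case 3
        then have "\<bar>?x + \<epsilon> * ?y\<bar> < \<bar>?x\<bar>" using i unfolding \<epsilon>_def by (auto simp: sgn_if)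
        then have "m (addrow \<epsilon> 0 i A) < m A" by (intro m_less[OF i(1)]) (use i A in \<open>auto simp: algebra_simps\<close>)
        then show ?thesis using i by (intro addrow_step[of 0 i \<epsilon>]) auto
      qed
    next
      case False
      define d where "d = A $$ (0, 0)"
      define w where "w = vec n (\<lambda>j. A $$ (0, Suc j))"
      define D where "D = mat n n (\<lambda>(i, j). A $$ (Suc i, Suc j))"
      have D: "D \<in> carrier_mat n n" and w: "w \<in> carrier_vec n" by (simp_all add: D_def w_def)
      have "A = four_block_mat (mat 1 1 (\<lambda>_. d)) (mat 1 n (\<lambda>(i, j). w $ j)) (0\<^sub>m n 1) D"
      proof (rule eq_matI)
        fix i j
        assume "i < dim_row (four_block_mat (mat 1 1 (\<lambda>_. d)) (mat 1 n (\<lambda>(i, j). w $ j)) (0\<^sub>m n 1) D)"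
          and "j < dim_col (four_block_mat (mat 1 1 (\<lambda>_. d)) (mat 1 n (\<lambda>(i, j). w $ j)) (0\<^sub>m n 1) D)"
        then show "A $$ (i, j) = four_block_mat (mat 1 1 (\<lambda>_. d)) (mat 1 n (\<lambda>(i, j). w $ j)) (0\<^sub>m n 1) D $$ (i, j)"
          using D False by (cases i; cases j) (auto simp: d_def w_def D_def)
      qed (use A D in auto)
      then have detA: "det A = d * det D"
        using det_four_block_mat_lower_left_zero_col[of "mat 1 1 (\<lambda>_. d)" "mat 1 n (\<lambda>(i, j). w $ j)" n "0\<^sub>m n 1" D] D
          det_single[of "mat 1 1 (\<lambda>_. d)"] by (simp del: One_nat_def)
      then have nz: "d \<noteq> 0" "det D \<noteq> 0" using less.prems(2) by auto
      obtain R where R: "residue_system D R" "int (card R) = \<bar>det D\<bar>" using IH[OF D nz(2)] by blast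
      have Av: "A *\<^sub>v vCons a x = vCons (d * a + w \<bullet> x) (D *\<^sub>v x)" if x: "x \<in> carrier_vec n" for a x
      proof (rule eq_vecI)
        fix i assume "i < dim_vec (vCons (d * a + w \<bullet> x) (D *\<^sub>v x))"
        then have "i < ?N" using D by simp
        then show "(A *\<^sub>v vCons a x) $ i = vCons (d * a + w \<bullet> x) (D *\<^sub>v x) $ i"
          using A x False
          by (cases i) (auto simp: scalar_prod_def d_def w_def D_def sum.atLeast0_lessThan_Suc_shift simp del: sum.op_ivl_Suc)
      qed (use A D in auto)
      show ?thesis
        using residue_system_block[OF D w nz R(1) A Av] R(2) detA by (auto simp: abs_mult intro!: exI)
    qed
  qed
qed

section \<open>Principal minors\<close>

text \<open>
  The principal submatrix on \<open>S\<close>, padded by the identity outside \<open>S\<close> so that the size, and hence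
  the index type, does not depend on \<open>S\<close>; its determinant is the principal minor.
\<close>

definition principal_mat :: "'b :: comm_ring_1 mat \<Rightarrow> nat set \<Rightarrow> 'b mat" where
  "principal_mat K S = mat (dim_row K) (dim_row K)
     (\<lambda>(i, j). if i \<in> S \<and> j \<in> S then K $$ (i, j) else if i = j then 1 else 0)"

lemma principal_mat_carrier [simp]:
  "K \<in> carrier_mat n n \<Longrightarrow> principal_mat K S \<in> carrier_mat n n"
  by (simp add: principal_mat_def)

lemma dim_principal_mat [simp]:
  "dim_row (principal_mat K S) = dim_row K" "dim_col (principal_mat K S) = dim_row K"
  by (simp_all add: principal_mat_def)

lemma principal_mat_mult_vec:
  assumes K: "K \<in> carrier_mat n n" and v: "v \<in> carrier_vec n" and i: "i < n" and S: "S \<subseteq> {0..<n}"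
  shows "(principal_mat K S *\<^sub>v v) $ i = (if i \<in> S then \<Sum>j\<in>S. K $$ (i, j) * v $ j else v $ i)"
proof -
  have "(principal_mat K S *\<^sub>v v) $ i =
      (\<Sum>j\<in>{0..<n}. if i \<in> S then (if j \<in> S then K $$ (i, j) * v $ j else 0)
        else (if i = j then v $ j else 0))"
    using assms by (auto simp: principal_mat_def scalar_prod_def intro!: sum.cong)
  also have "\<dots> = (if i \<in> S then \<Sum>j\<in>{0..<n}. if j \<in> S then K $$ (i, j) * v $ j else 0
      else \<Sum>j\<in>{0..<n}. if i = j then v $ j else 0)"
    by simp
  also have "\<dots> = (if i \<in> S then \<Sum>j\<in>S. K $$ (i, j) * v $ j else v $ i)"
    using i S by (simp add: sum.inter_restrict[symmetric] Int_absorb1)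
  finally show ?thesis .
qed

text \<open>In the Leibniz formula each product of sums is expanded over the set \<open>S\<close> of
  rows that contribute their entry of \<open>K\<close>. After exchanging the two sums, the inner sum
  for \<open>S\<close> is the Leibniz formula of a principal minor.\<close>

lemma det_one_plus:
  fixes K :: "'b :: comm_ring_1 mat"
  assumes K: "K \<in> carrier_mat n n"
  shows "det (1\<^sub>m n + K) = (\<Sum>S\<in>Pow {0..<n}. det (principal_mat K S))"
proof -
  let ?P = "{p. p permutes {0..<n}}"
  \<comment> \<open>Both sides vanish unless \<open>p\<close> fixes every index outside
    \<open>S\<close>. In that case \<open>p\<close> maps \<open>S\<close> into itself and only
    entries of \<open>K\<close> within \<open>S\<close> occur.\<close>
  have term_eq: "(\<Prod>i\<in>S. K $$ (i, p i)) * (\<Prod>i\<in>{0..<n} - S. (1\<^sub>m n :: 'b mat) $$ (i, p i)) =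
      (\<Prod>i\<in>{0..<n}. principal_mat K S $$ (i, p i))"
    if p: "p permutes {0..<n}" and S: "S \<subseteq> {0..<n}" for p S
  proof -
    have pn: "p i < n" if "i < n" for i using permutes_in_image[OF p, of i] that by simp
    have prod_split: "(\<Prod>i\<in>{0..<n}. principal_mat K S $$ (i, p i)) =
        (\<Prod>i\<in>S. principal_mat K S $$ (i, p i)) * (\<Prod>i\<in>{0..<n} - S. principal_mat K S $$ (i, p i))"
      using prod.subset_diff[OF S] by (simp add: mult.commute)
    have off: "principal_mat K S $$ (i, p i) = (1\<^sub>m n :: 'b mat) $$ (i, p i)" if "i \<in> {0..<n} - S" for i
      using that pn K by (auto simp: principal_mat_def)
    have rest: "(\<Prod>i\<in>{0..<n} - S. principal_mat K S $$ (i, p i)) =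
        (\<Prod>i\<in>{0..<n} - S. (1\<^sub>m n :: 'b mat) $$ (i, p i))"
      by (rule prod.cong) (use off in auto)
    show ?thesis
    proof (cases "\<forall>i\<in>{0..<n} - S. p i = i")
      case True
      have "p i \<in> S" if "i \<in> S" for i
      proof (rule ccontr)
        assume "p i \<notin> S"
        then have "p (p i) = p i" using True pn S that by auto
        then have "p i = i" using permutes_inj[OF p] by (metis injD)
        then show False using that \<open>p i \<notin> S\<close> by simp
      qed
      then have "(\<Prod>i\<in>S. principal_mat K S $$ (i, p i)) = (\<Prod>i\<in>S. K $$ (i, p i))"
        using S pn K by (intro prod.cong) (auto simp: principal_mat_def)
      then show ?thesis by (simp add: prod_split rest)
    next
      case False
      then obtain i where "i \<in> {0..<n} - S" "p i \<noteq> i" by blast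
      then have "(\<Prod>i\<in>{0..<n} - S. (1\<^sub>m n :: 'b mat) $$ (i, p i)) = 0"
        using pn by (intro prod_zero) (auto intro!: bexI[of _ i])
      then show ?thesis by (simp add: prod_split rest)
    qed
  qed
  have pn: "p i < n" if "i < n" "p permutes {0..<n}" for i p
    using permutes_in_image[OF that(2), of i] that by simp
  have "det (1\<^sub>m n + K) = (\<Sum>p\<in>?P. signof p * (\<Prod>i\<in>{0..<n}. K $$ (i, p i) + (1\<^sub>m n :: 'b mat) $$ (i, p i)))"
    using K pn by (subst det_def'[of _ n]) (auto intro!: sum.cong prod.cong simp: add.commute)
  also have "\<dots> = (\<Sum>p\<in>?P. \<Sum>S\<in>Pow {0..<n}. signof p *
      ((\<Prod>i\<in>S. K $$ (i, p i)) * (\<Prod>i\<in>{0..<n} - S. (1\<^sub>m n :: 'b mat) $$ (i, p i))))"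
    by (simp add: prod_add sum_distrib_left)
  also have "\<dots> = (\<Sum>S\<in>Pow {0..<n}. \<Sum>p\<in>?P. signof p *
      ((\<Prod>i\<in>S. K $$ (i, p i)) * (\<Prod>i\<in>{0..<n} - S. (1\<^sub>m n :: 'b mat) $$ (i, p i))))"
    by (rule sum.swap)
  also have "\<dots> = (\<Sum>S\<in>Pow {0..<n}. det (principal_mat K S))"
    using K term_eq by (intro sum.cong refl) (auto simp: det_def'[of _ n] intro!: sum.cong)
  finally show ?thesis .
qed

text \<open>The monic characteristic polynomial of \<open>-A\<close> has no positive root, so it is nonnegative at 0.\<close>

lemma det_nonneg_of_quadratic_form_nonneg:
  fixes A :: "real mat"
  assumes A: "A \<in> carrier_mat n n" and nonneg: "\<And>v. v \<in> carrier_vec n \<Longrightarrow> 0 \<le> v \<bullet> (A *\<^sub>v v)"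
  shows "0 \<le> det A"
proof (rule ccontr)
  assume neg: "\<not> 0 \<le> det A"
  let ?p = "char_poly (- A)"
  have mA: "- A \<in> carrier_mat n n" using A by simp
  have "poly ?p 0 = det A" unfolding char_poly_matrix[OF mA]
    by (rule arg_cong[of _ _ det], rule eq_matI) (use A in \<open>auto simp: char_matrix_def\<close>)
  then have p0: "poly ?p 0 < 0" using neg by simp
  have monic: "lead_coeff ?p = 1" using degree_monic_char_poly[OF mA] by simp
  obtain b where b: "\<And>x. x \<ge> b \<Longrightarrow> poly ?p x \<ge> 1"
    using poly_pinfty_gt_lc[of ?p] monic by auto
  have "poly ?p (max b 1) > 0" using b[of "max b 1"] by simp
  then obtain t where t: "t > 0" "poly ?p t = 0"
    using poly_IVT_pos[of 0 "max b 1" ?p] p0 by fastforce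
  \<comment> \<open>An eigenvector \<open>v\<close> of \<open>- A\<close> for a positive
    \<open>t\<close> satisfies
    \<open>v \<bullet> (A *\<^sub>v v) = - t * (v \<bullet> v) < 0\<close>, against nonnegativity of
    the form.\<close>
  then have "eigenvalue (- A) t" using eigenvalue_root_char_poly[OF mA] by simp
  then obtain v where v: "v \<in> carrier_vec n" "v \<noteq> 0\<^sub>v n" "- A *\<^sub>v v = t \<cdot>\<^sub>v v"
    using A unfolding eigenvalue_def eigenvector_def by auto
  have "v \<bullet> (- A *\<^sub>v v) = - (v \<bullet> (A *\<^sub>v v))" using v(1) A by (simp add: uminus_mult_mat_vec)
  moreover have "v \<bullet> (- A *\<^sub>v v) = t * (v \<bullet> v)" using v(1,3) by simp
  moreover have "v \<bullet> v > 0"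
    using v(1,2) conjugate_square_greater_0_vec[of v n] by simp
  ultimately show False using nonneg[OF v(1)] t(1)
    by (metis mult_pos_pos neg_0_le_iff_le not_le minus_minus)
qed

text \<open>Over the reals the quadratic form of the padded matrix is a sum of squares from the
  padding, since the part on \<open>S\<close> cancels by skew-symmetry.\<close>

lemma det_principal_mat_nonneg:
  fixes K :: "int mat"
  assumes K: "K \<in> carrier_mat n n" and S: "S \<subseteq> {0..<n}"
    and skew: "\<And>i j. i < n \<Longrightarrow> j < n \<Longrightarrow> K $$ (i, j) = - K $$ (j, i)"
  shows "0 \<le> det (principal_mat K S)"
proof -
  let ?A = "map_mat real_of_int (principal_mat K S)"
  have eq: "?A = principal_mat (map_mat real_of_int K) S"
    by (rule eq_matI) (use K in \<open>auto simp: principal_mat_def\<close>)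
  have "0 \<le> v \<bullet> (?A *\<^sub>v v)" if v: "v \<in> carrier_vec n" for v
  proof -
    let ?s = "\<Sum>i\<in>S. \<Sum>j\<in>S. v $ i * (real_of_int (K $$ (i, j)) * v $ j)"
    have "?s = (\<Sum>i\<in>S. \<Sum>j\<in>S. v $ j * (real_of_int (K $$ (j, i)) * v $ i))" by (rule sum.swap)
    also have "\<dots> = (\<Sum>i\<in>S. \<Sum>j\<in>S. - (v $ i * (real_of_int (K $$ (i, j)) * v $ j)))"
    proof (intro sum.cong refl)
      fix i j assume "i \<in> S" "j \<in> S"
      then have "K $$ (j, i) = - K $$ (i, j)" using S skew[of j i] by (meson atLeastLessThan_iff subsetD)
      then show "v $ j * (real_of_int (K $$ (j, i)) * v $ i) = - (v $ i * (real_of_int (K $$ (i, j)) * v $ j))"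
        by simp
    qed
    also have "\<dots> = - ?s" by (simp add: sum_negf)
    finally have s0: "?s = 0" by simp
    have "v \<bullet> (?A *\<^sub>v v) = (\<Sum>i\<in>{0..<n}. v $ i * (?A *\<^sub>v v) $ i)"
      using v K by (simp add: scalar_prod_def[of v])
    also have "\<dots> = (\<Sum>i\<in>{0..<n}. v $ i * (if i \<in> S then \<Sum>j\<in>S. map_mat real_of_int K $$ (i, j) * v $ j else v $ i))"
      unfolding eq using K v S by (intro sum.cong refl) (simp add: principal_mat_mult_vec[of _ n] del: index_mult_mat_vec)
    also have "\<dots> = (\<Sum>i\<in>{0..<n} - S. v $ i * v $ i) + (\<Sum>i\<in>S. v $ i * (\<Sum>j\<in>S. map_mat real_of_int K $$ (i, j) * v $ j))"
      using S by (subst sum.subset_diff[OF S]) auto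
    also have "(\<Sum>i\<in>S. v $ i * (\<Sum>j\<in>S. map_mat real_of_int K $$ (i, j) * v $ j)) = ?s"
      unfolding sum_distrib_left using K S by (intro sum.cong refl) (auto simp: subset_iff)
    finally show ?thesis unfolding s0 by (simp add: sum_nonneg)
  qed
  then have "0 \<le> det ?A"
    using K by (intro det_nonneg_of_quadratic_form_nonneg[of _ n]) auto
  then show ?thesis by (simp add: of_int_hom.hom_det)
qed

section \<open>Transversals\<close>

text \<open>For a transversal \<open>T\<close> this is its element over \<open>e\<close>. For any
  other \<open>T\<close> it still chooses one of \<open>e\<close> and its copy, so most rules about
  it carry no hypothesis on \<open>T\<close>.\<close>

definition sel :: "('a + 'a) set \<Rightarrow> 'a \<Rightarrow> 'a + 'a" where
  "sel T e = (if Inl e \<in> T then Inl e else Inr e)"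

text \<open>For a basis \<open>B\<close> this is the set \<open>B_S\<close> of the overview. Being
  assembled from values of \<open>sel\<close>, it is a transversal whatever \<open>T\<close>
  is.\<close>

definition switch :: "'a set \<Rightarrow> ('a + 'a) set \<Rightarrow> 'a set \<Rightarrow> ('a + 'a) set" where
  "switch E T S = sel T ` (E - S) \<union> (star \<circ> sel T) ` S"

lemma star_star [simp]: "star (star x) = x"
  by (simp add: star_def split: sum.split)

lemma star_simps [simp]: "star (Inl e) = Inr e" "star (Inr e) = Inl e"
  by (simp_all add: star_def)

lemma ground_iff [simp]: "Inl e \<in> ground E \<longleftrightarrow> e \<in> E" "Inr e \<in> ground E \<longleftrightarrow> e \<in> E"
  by (auto simp: ground_def)

lemma finite_ground: "finite E \<Longrightarrow> finite (ground E)"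
  by (simp add: ground_def)

lemma sel_ground [simp]: "sel T e \<in> ground E \<longleftrightarrow> e \<in> E" "star (sel T e) \<in> ground E \<longleftrightarrow> e \<in> E"
  by (auto simp: sel_def)

lemma sel_eq_iff [simp]:
  "sel T e = sel T f \<longleftrightarrow> e = f" "star (sel T e) = star (sel T f) \<longleftrightarrow> e = f"
  "sel T e \<noteq> star (sel T f)" "star (sel T f) \<noteq> sel T e"
  by (auto simp: sel_def)

lemma ground_cases:
  assumes "x \<in> ground E"
  obtains e where "e \<in> E" "x = sel T e" | e where "e \<in> E" "x = star (sel T e)"
proof -
  obtain e where "e \<in> E" "x = Inl e \<or> x = Inr e" using assms by (auto simp: ground_def)
  moreover from this have "x = sel T e \<or> x = star (sel T e)" by (auto simp: sel_def)
  ultimately show ?thesis using that by blast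
qed

lemma sum_ground:
  assumes "finite E"
  shows "(\<Sum>x\<in>ground E. F x) = (\<Sum>e\<in>E. F (sel T e) + F (star (sel T e)))"
  using assms unfolding ground_def
  by (simp add: sum.Plus flip: sum.distrib) (auto simp: sel_def add.commute intro!: sum.cong)

lemma zero_outside_supp: "supp E C \<subseteq> T \<Longrightarrow> x \<in> ground E \<Longrightarrow> x \<notin> T \<Longrightarrow> C x = 0"
  by (auto simp: supp_def)

text \<open>Forgetting the star is injective on a set without pairs, so such a set has
  \<open>card E\<close> elements exactly when this map is onto \<open>E\<close>, that is, when every
  pair is met.\<close>

lemma transversal_iff:
  assumes "finite E"
  shows "transversal E T \<longleftrightarrow> T \<subseteq> ground E \<and> (\<forall>e\<in>E. Inl e \<in> T \<longleftrightarrow> Inr e \<notin> T)"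
proof -
  let ?u = "case_sum id id :: 'a + 'a \<Rightarrow> 'a"
  have "transversal E T \<longleftrightarrow> (\<forall>e\<in>E. Inl e \<in> T \<longleftrightarrow> Inr e \<notin> T)" if T: "T \<subseteq> ground E"
  proof -
    have uT: "?u ` T \<subseteq> E" using T by (auto simp: ground_def)
    have no_pair: "(\<exists>e \<in> ground E. {e, star e} \<subseteq> T) \<longleftrightarrow> (\<exists>e\<in>E. Inl e \<in> T \<and> Inr e \<in> T)"
      by (auto simp: ground_def)
    have inj: "inj_on ?u T" if "\<not> (\<exists>e\<in>E. Inl e \<in> T \<and> Inr e \<in> T)"
    proof (rule inj_onI)
      fix x y assume "x \<in> T" "y \<in> T" "?u x = ?u y"
      then show "x = y" using that T by (cases x; cases y) (auto simp: ground_def)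
    qed
    show ?thesis
    proof
      assume tr: "transversal E T"
      then have np: "\<not> (\<exists>e\<in>E. Inl e \<in> T \<and> Inr e \<in> T)" and cd: "card T = card E"
        using no_pair by (auto simp: transversal_def)
      have "?u ` T = E" using card_image[OF inj[OF np]] cd uT assms by (simp add: card_subset_eq)
      moreover have "Inl e \<in> T \<or> Inr e \<in> T" if e: "e \<in> ?u ` T" for e
      proof -
        obtain x where "x \<in> T" "e = ?u x" using e by auto
        then show ?thesis by (cases x) auto
      qed
      ultimately show "\<forall>e\<in>E. Inl e \<in> T \<longleftrightarrow> Inr e \<notin> T" using np by blast
    next
      assume one: "\<forall>e\<in>E. Inl e \<in> T \<longleftrightarrow> Inr e \<notin> T"
      then have np: "\<not> (\<exists>e\<in>E. Inl e \<in> T \<and> Inr e \<in> T)" by blast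
      have "e \<in> ?u ` T" if "e \<in> E" for e using one that by (cases "Inl e \<in> T") force+
      then have "?u ` T = E" using uT by blast
      then have "card T = card E" using card_image[OF inj[OF np]] by simp
      then show "transversal E T" using T np no_pair by (simp add: transversal_def)
    qed
  qed
  moreover have "transversal E T \<Longrightarrow> T \<subseteq> ground E" by (simp add: transversal_def)
  ultimately show ?thesis by blast
qed

lemma sel_mem:
  assumes "finite E" "transversal E T" "e \<in> E"
  shows "sel T e \<in> T" "star (sel T e) \<notin> T"
  using assms by (auto simp: transversal_iff sel_def)

lemma mem_switch_iff:
  assumes "S \<subseteq> E"
  shows "sel T e \<in> switch E T S \<longleftrightarrow> e \<in> E - S" "star (sel T e) \<in> switch E T S \<longleftrightarrow> e \<in> S"
  using assms by (auto simp: switch_def)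

lemma sel_switch:
  assumes "S \<subseteq> E" "e \<in> E"
  shows "sel (switch E T S) e = (if e \<in> S then star (sel T e) else sel T e)"
  using mem_switch_iff[OF assms(1), of T e] assms(2) by (auto simp: sel_def split: if_splits)

lemma transversal_switch:
  assumes "finite E" "S \<subseteq> E"
  shows "transversal E (switch E T S)"
  unfolding transversal_iff[OF assms(1)]
proof (intro conjI ballI)
  show "switch E T S \<subseteq> ground E" using assms(2) by (auto simp: switch_def)
  fix e assume "e \<in> E"
  then show "Inl e \<in> switch E T S \<longleftrightarrow> Inr e \<notin> switch E T S"
    using mem_switch_iff[OF assms(2), of T e] by (auto simp: sel_def split: if_splits)
qed

text \<open>Turns a sum over index sets of principal minors into a sum over transversals. The
  preimage of \<open>T'\<close> is the set of places where \<open>T'\<close> disagrees with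
  \<open>sel T\<close>.\<close>

lemma bij_betw_switch:
  assumes E: "finite E"
  shows "bij_betw (switch E T) (Pow E) {T'. transversal E T'}"
proof (rule bij_betw_imageI)
  show "inj_on (switch E T) (Pow E)"
  proof (rule inj_onI)
    fix S S' assume "S \<in> Pow E" "S' \<in> Pow E" "switch E T S = switch E T S'"
    then show "S = S'" using mem_switch_iff(2)[of S E T] mem_switch_iff(2)[of S' E T] by auto
  qed
  have "T' \<in> switch E T ` Pow E" if T': "transversal E T'" for T'
  proof (rule image_eqI)
    let ?S = "{e \<in> E. star (sel T e) \<in> T'}"
    show "?S \<in> Pow E" by simp
    have one: "star (sel T e) \<in> T' \<longleftrightarrow> sel T e \<notin> T'" if "e \<in> E" for e
      using T' that by (auto simp: transversal_iff[OF E] sel_def)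
    have sub: "T' \<subseteq> ground E" "switch E T ?S \<subseteq> ground E"
      using T' transversal_switch[OF E, of ?S T] by (auto simp: transversal_def)
    have "x \<in> T' \<longleftrightarrow> x \<in> switch E T ?S" if "x \<in> ground E" for x
      using that by (cases x rule: ground_cases[of _ _ T]) (auto simp: mem_switch_iff one)
    then show "T' = switch E T ?S" using sub by blast
  qed
  then show "switch E T ` Pow E = {T'. transversal E T'}" using transversal_switch[OF E] by auto
qed

lemma proj_apply: "e \<in> E \<Longrightarrow> proj E v e = v (sel T e) + v (star (sel T e))"
  by (simp add: proj_def sel_def)

section \<open>Cosets and integer vectors\<close>

text \<open>Lets the number of cosets be read off a set of representatives, the form in which a
  residue system supplies it.\<close>

lemma (in group) bij_betw_rcosets:
  assumes H: "subgroup H G" and R: "R \<subseteq> carrier G"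
    and uniq: "\<And>x. x \<in> carrier G \<Longrightarrow> \<exists>!r. r \<in> R \<and> x \<in> H #> r"
  shows "bij_betw ((#>) H) R (rcosets H)"
proof (rule bij_betw_imageI)
  show "inj_on ((#>) H) R"
  proof (rule inj_onI)
    fix r s assume rs: "r \<in> R" "s \<in> R" "H #> r = H #> s"
    then have "r \<in> H #> r" "r \<in> H #> s" using R rcos_self[OF _ H, of r] by auto
    then show "r = s" using uniq[of r] rs R by blast
  qed
  have "H #> x \<in> (#>) H ` R" if x: "x \<in> carrier G" for x
  proof -
    obtain r where r: "r \<in> R" "x \<in> H #> r" using uniq[OF x] by blast
    then have "H #> r = H #> x" using R repr_independence[OF _ _ H] by blast
    then show ?thesis using r by blast
  qed
  then show "(#>) H ` R = rcosets H" using R unfolding RCOSETS_def by auto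
qed

lemma carrier_int_vectors [simp]: "carrier (int_vectors I) = (\<Pi>\<^sub>E i\<in>I. UNIV)"
  by (simp add: int_vectors_def)

lemma mult_int_vectors [simp]: "v \<otimes>\<^bsub>int_vectors I\<^esub> w = (\<lambda>i\<in>I. v i + w i)"
  by (simp add: int_vectors_def)

lemma one_int_vectors [simp]: "\<one>\<^bsub>int_vectors I\<^esub> = (\<lambda>i\<in>I. 0)"
  by (simp add: int_vectors_def)

lemma inv_int_vectors [simp]:
  "v \<in> (\<Pi>\<^sub>E i\<in>I. UNIV) \<Longrightarrow> inv\<^bsub>int_vectors I\<^esub> v = (\<lambda>i\<in>I. - v i)"
  by (simp add: int_vectors_def)

lemma group_int_vectors [simp]: "group (int_vectors I)"
  by (simp add: int_vectors_def)

text \<open>Closure under integer multiples comes from the group operations by induction on the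
  scalar, upwards and downwards from 0.\<close>

lemma sum_mem_subgroup_int_vectors:
  assumes H: "subgroup H (int_vectors I)" and J: "finite J" and w: "\<And>j. j \<in> J \<Longrightarrow> w j \<in> H"
  shows "(\<lambda>i\<in>I. \<Sum>j\<in>J. c j * w j i) \<in> H"
proof -
  interpret subgroup H "int_vectors I" by (rule H)
  have add: "(\<lambda>i\<in>I. v i + w i) \<in> H" if "(\<lambda>i\<in>I. v i) \<in> H" "(\<lambda>i\<in>I. w i) \<in> H" for v w
    using m_closed[OF that] by (simp add: restrict_def cong: if_cong)
  have neg: "(\<lambda>i\<in>I. - v i) \<in> H" if "(\<lambda>i\<in>I. v i) \<in> H" for v
  proof -
    have "inv\<^bsub>int_vectors I\<^esub> (\<lambda>i\<in>I. v i) = (\<lambda>i\<in>I. - v i)" by (subst inv_int_vectors) auto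
    then show ?thesis using m_inv_closed[OF that] by simp
  qed
  have zero: "(\<lambda>i\<in>I. 0) \<in> H" using one_closed by (simp only: one_int_vectors)
  have mult: "(\<lambda>i\<in>I. k * v i) \<in> H" if v: "v \<in> H" for k v
  proof -
    have v': "(\<lambda>i\<in>I. v i) \<in> H"
      using v subset by (metis carrier_int_vectors extensional_restrict PiE_iff subsetD)
    show ?thesis
    proof (induction k rule: int_induct[of _ 0])
      case base
      then show ?case using zero by (simp only: mult_zero_left)
    next
      case (step1 k)
      then show ?case using add[OF step1(2) v'] by (simp only: distrib_right mult_1)
    next
      case (step2 k)
      then show ?case using add[OF step2(2) neg[OF v']]
        by (simp only: left_diff_distrib mult_1 add_uminus_conv_diff)
    qed
  qed
  show ?thesis using J w
  proof (induction J)
    case empty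
    then show ?case using zero by (simp only: sum.empty)
  next
    case (insert j J)
    have "(\<lambda>i\<in>I. \<Sum>j\<in>J. c j * w j i) \<in> H" by (rule insert.IH) (rule insert.prems, blast)
    from add[OF mult[OF insert.prems[OF insertI1]] this, of "c j"]
    have "(\<lambda>i\<in>I. c j * w j i + (\<Sum>j\<in>J. c j * w j i)) \<in> H" .
    then show ?case using insert(1,2) by (simp only: sum.insert not_False_eq_True)
  qed
qed

section \<open>Fundamental circuits and the Jacobian group\<close>

locale regular_representation =
  fixes E :: "'a set" and \<B> :: "('a + 'a) set set" and \<C> :: "('a + 'a \<Rightarrow> int) set"
  assumes orthogonal_matroid: "orthogonal_matroid E \<B>"
    and representation: "regular_orthogonal_representation E \<B> \<C>"
begin

lemma finite_E: "finite E" and bases_nonempty: "\<B> \<noteq> {}"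
  and transversal_basis: "B \<in> \<B> \<Longrightarrow> transversal E B"
  using orthogonal_matroid by (auto simp: orthogonal_matroid_def)

text \<open>The only element of \<open>B\<close> outside the switched set is \<open>sel B e\<close>,
  while the exchange axiom would demand a second one. This is the source of fundamental
  circuits.\<close>

lemma switch_single_not_basis:
  assumes B: "B \<in> \<B>" and e: "e \<in> E"
  shows "switch E B {e} \<notin> \<B>"
proof
  assume B': "switch E B {e} \<in> \<B>"
  have sub: "B \<subseteq> ground E" using transversal_basis[OF B] by (simp add: transversal_def)
  have "x = sel B e" if "x \<in> B - switch E B {e}" for x
  proof -
    have "x \<in> ground E" using that sub by blast
    then show ?thesis using that e sel_mem[OF finite_E transversal_basis[OF B]]
      by (cases x rule: ground_cases[of _ _ B]) (auto simp: mem_switch_iff)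
  qed
  moreover have "sel B e \<in> B - switch E B {e}"
    using e sel_mem[OF finite_E transversal_basis[OF B]] by (simp add: mem_switch_iff)
  moreover have "\<forall>x \<in> B - switch E B {e}. \<exists>f \<in> B - switch E B {e}. f \<noteq> x"
    using orthogonal_matroid B B' unfolding orthogonal_matroid_def by blast
  ultimately show False by blast
qed

lemma circuit_not_subset_basis:
  assumes "C \<in> \<C>" "B \<in> \<B>"
  shows "\<not> supp E C \<subseteq> B"
proof -
  have "supp E C \<in> circuits E \<B>"
    using assms representation unfolding regular_orthogonal_representation_def by blast
  then show ?thesis using assms(2) unfolding circuits_def Let_def by blast
qed

text \<open>A transversal contained in a basis equals it by cardinality, so a nonbasis is dependent.
  A minimal dependent subset of it is a circuit and therefore a support.\<close>

lemma circuit_in_nonbasis: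
  assumes T: "transversal E T" "T \<notin> \<B>"
  obtains C where "C \<in> \<C>" "supp E C \<subseteq> T"
proof -
  define dep where "dep S \<longleftrightarrow> subtransversal E S \<and> \<not> (\<exists>B \<in> \<B>. S \<subseteq> B)" for S
  have finT: "finite T" using T(1) finite_ground[OF finite_E] unfolding transversal_def
    by (blast intro: finite_subset)
  have "T = B" if "B \<in> \<B>" "T \<subseteq> B" for B
    using T(1) transversal_basis[OF that(1)] that(2) finite_ground[OF finite_E]
    unfolding transversal_def by (metis card_subset_eq finite_subset)
  then have "dep T" using T unfolding dep_def subtransversal_def by blast
  then have "finite {S. S \<subseteq> T \<and> dep S}" "{S. S \<subseteq> T \<and> dep S} \<noteq> {}" using finT by auto
  from finite_has_minimal[OF this]
  obtain S where S: "S \<subseteq> T" "dep S" "\<And>S'. S' \<subseteq> T \<Longrightarrow> dep S' \<Longrightarrow> S' \<subseteq> S \<Longrightarrow> S = S'"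
    by auto
  then have "\<not> (\<exists>S'. S' \<subset> S \<and> dep S')" by blast
  with S(2) have "S \<in> circuits E \<B>" unfolding circuits_def Let_def dep_def by simp
  then have "S \<in> supp E ` \<C>"
    using representation unfolding regular_orthogonal_representation_def by blast
  then show ?thesis using that S(1) by blast
qed

lemma uminus_circuit: "C \<in> \<C> \<Longrightarrow> (\<lambda>x\<in>ground E. - C x) \<in> \<C>"
  using representation unfolding regular_orthogonal_representation_def by blast

text \<open>Exchanging a single element destroys the basis, so the new transversal contains a
  circuit. It must use the new element, as otherwise it would lie in \<open>B\<close>; closure of
  \<open>\<C>\<close> under negation makes that entry 1.\<close>

lemma fundamental_circuit:
  assumes B: "B \<in> \<B>" and e: "e \<in> E"
  obtains C where "C \<in> \<C>" "C (star (sel B e)) = 1" "C (sel B e) = 0"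
    "\<And>f. f \<in> E \<Longrightarrow> f \<noteq> e \<Longrightarrow> C (star (sel B f)) = 0"
proof -
  obtain C where C: "C \<in> \<C>" "supp E C \<subseteq> switch E B {e}"
    using circuit_in_nonbasis transversal_switch finite_E switch_single_not_basis[OF B e] e
    by (metis empty_subsetI insert_subset)
  have zero: "C (sel B e) = 0" "\<And>f. f \<in> E \<Longrightarrow> f \<noteq> e \<Longrightarrow> C (star (sel B f)) = 0"
    by (rule zero_outside_supp[OF C(2)]; use e in \<open>simp add: mem_switch_iff\<close>)+
  have "C (star (sel B e)) \<noteq> 0"
  proof
    assume 0: "C (star (sel B e)) = 0"
    have "x \<in> B" if "x \<in> ground E" "C x \<noteq> 0" for x
      using that 0 zero sel_mem[OF finite_E transversal_basis[OF B]]
      by (cases x rule: ground_cases[of _ _ B]) auto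
    then have "supp E C \<subseteq> B" by (auto simp: supp_def)
    then show False using circuit_not_subset_basis[OF C(1) B] by simp
  qed
  moreover have "C (star (sel B e)) \<in> {0, 1, -1}"
    using representation C(1) e unfolding regular_orthogonal_representation_def by simp
  ultimately consider "C (star (sel B e)) = 1" | "C (star (sel B e)) = -1" by auto
  then show ?thesis
  proof cases
    case 1
    then show ?thesis using that C(1) zero by blast
  next
    case 2
    then show ?thesis using that[OF uminus_circuit[OF C(1)]] e zero by simp
  qed
qed

lemma orthogonal:
  assumes "C \<in> \<C>" "D \<in> \<C>"
  shows "(\<Sum>e\<in>E. C (sel B e) * D (star (sel B e)) + C (star (sel B e)) * D (sel B e)) = 0"
proof -
  have "(\<Sum>x \<in> ground E. C x * dual_vector D x) = 0"
    using assms representation unfolding regular_orthogonal_representation_def by blast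
  then show ?thesis by (simp add: sum_ground[OF finite_E, of _ B] dual_vector_def)
qed

end

section \<open>The skew-symmetric matrix of fundamental circuits at a fixed basis\<close>

locale representation_at_basis = regular_representation +
  fixes B :: "('a + 'a) set" and n :: nat and h :: "nat \<Rightarrow> 'a"
  assumes B: "B \<in> \<B>" and h: "bij_betw h {0..<n} E"
begin

text \<open>The circuit \<open>C_e\<close> of the overview. The choice is harmless: by
  \<open>circuit_expansion\<close> a vector of \<open>\<C>\<close> is determined by its values on
  the elements \<open>star (sel B f)\<close>.\<close>

definition fund :: "'a \<Rightarrow> 'a + 'a \<Rightarrow> int" where
  "fund e = (SOME C. C \<in> \<C> \<and> C (star (sel B e)) = 1 \<and> C (sel B e) = 0 \<and>
     (\<forall>f\<in>E. f \<noteq> e \<longrightarrow> C (star (sel B f)) = 0))"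

lemma fund:
  assumes "e \<in> E"
  shows "fund e \<in> \<C>" "f \<in> E \<Longrightarrow> fund e (star (sel B f)) = (if f = e then 1 else 0)"
proof -
  have "\<exists>C. C \<in> \<C> \<and> C (star (sel B e)) = 1 \<and> C (sel B e) = 0 \<and>
     (\<forall>f\<in>E. f \<noteq> e \<longrightarrow> C (star (sel B f)) = 0)"
    using fundamental_circuit[OF B assms] by metis
  from someI_ex[OF this] show "fund e \<in> \<C>" "f \<in> E \<Longrightarrow> fund e (star (sel B f)) = (if f = e then 1 else 0)"
    unfolding fund_def[symmetric] by auto
qed

text \<open>Off \<open>B\<close>, the vector \<open>fund f\<close> has a single nonzero entry, so
  orthogonality to it isolates the entry of \<open>D\<close> at \<open>sel B f\<close>.\<close>

lemma orthogonal_fund: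
  assumes "D \<in> \<C>" "f \<in> E"
  shows "D (sel B f) = - (\<Sum>g\<in>E. D (star (sel B g)) * fund f (sel B g))"
proof -
  have "(\<Sum>g\<in>E. D (sel B g) * (if g = f then 1 else 0) + D (star (sel B g)) * fund f (sel B g)) = 0"
    using orthogonal[OF assms(1) fund(1)[OF assms(2)], of B] fund(2)[OF assms(2)] by (simp cong: sum.cong)
  then show ?thesis using assms(2) finite_E
    by (simp add: sum.distrib if_distrib[of "(*) _"] cong: if_cong)
qed

text \<open>The case \<open>D = fund e\<close> of \<open>orthogonal_fund\<close>, where the sum has
  one nonzero term.\<close>

lemma fund_skew:
  assumes "e \<in> E" "f \<in> E"
  shows "fund e (sel B f) = - fund f (sel B e)"
proof -
  have "(\<Sum>g\<in>E. fund e (star (sel B g)) * fund f (sel B g)) =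
      (\<Sum>g\<in>E. if g = e then fund f (sel B g) else 0)"
    using fund(2)[OF assms(1)] by (intro sum.cong) auto
  then show ?thesis using orthogonal_fund[OF fund(1)[OF assms(1)] assms(2)] assms(1) finite_E by simp
qed

text \<open>The substantial half of writing \<open>D\<close> as a combination of fundamental
  circuits: on the starred elements the same identity is immediate from \<open>fund\<close>.\<close>

lemma circuit_expansion:
  assumes "D \<in> \<C>" "f \<in> E"
  shows "D (sel B f) = (\<Sum>g\<in>E. fund g (sel B f) * D (star (sel B g)))"
proof -
  have "D (sel B f) = (\<Sum>g\<in>E. - fund f (sel B g) * D (star (sel B g)))"
    unfolding orthogonal_fund[OF assms] by (simp add: sum_negf mult.commute)
  also have "\<dots> = (\<Sum>g\<in>E. fund g (sel B f) * D (star (sel B g)))"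
    using fund_skew[OF _ assms(2)] by (intro sum.cong) auto
  finally show ?thesis .
qed

definition K :: "int mat" where
  "K = mat n n (\<lambda>(i, j). fund (h j) (sel B (h i)))"

lemma K_carrier [simp]: "K \<in> carrier_mat n n"
  by (simp add: K_def)

lemma dim_K [simp]: "dim_row K = n" "dim_col K = n"
  by (simp_all add: K_def)

lemma h_mem [simp]: "i < n \<Longrightarrow> h i \<in> E"
  using h by (auto simp: bij_betw_def)

lemma h_eq_iff: "i < n \<Longrightarrow> j < n \<Longrightarrow> h i = h j \<longleftrightarrow> i = j"
  using h by (auto simp: bij_betw_def inj_on_def)

lemma ball_E_iff: "(\<forall>e\<in>E. P e) \<longleftrightarrow> (\<forall>i<n. P (h i))"
  using bij_betw_imp_surj_on[OF h] by force

lemma K_skew: "i < n \<Longrightarrow> j < n \<Longrightarrow> K $$ (i, j) = - K $$ (j, i)"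
  using fund_skew[OF h_mem h_mem, of j i] by (simp add: K_def)

lemma circuit_expansion_K:
  assumes "D \<in> \<C>" "i < n"
  shows "D (sel B (h i)) = (\<Sum>j\<in>{0..<n}. K $$ (i, j) * D (star (sel B (h j))))"
  using circuit_expansion[OF assms(1) h_mem[OF assms(2)]] assms(2)
  by (simp add: sum.reindex_bij_betw[OF h, symmetric] K_def)

text \<open>For rows in \<open>S\<close> this says that the principal submatrix sends the starred
  entries of \<open>D\<close> to its entries on \<open>B\<close>.\<close>

lemma circuit_expansion_sub:
  assumes "D \<in> \<C>" "S \<subseteq> {0..<n}" and "\<And>j. j < n \<Longrightarrow> j \<notin> S \<Longrightarrow> D (star (sel B (h j))) = 0" and "i < n"
  shows "(\<Sum>j\<in>S. K $$ (i, j) * D (star (sel B (h j)))) = D (sel B (h i))"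
  unfolding circuit_expansion_K[OF assms(1,4)]
  by (rule sum.mono_neutral_left) (use assms in auto)

section \<open>Principal minors detect bases\<close>

lemma det_principal_mat_K:
  assumes S: "S \<subseteq> {0..<n}"
  shows "det (principal_mat K S) = (if switch E B (h ` S) \<in> \<B> then 1 else 0)"
proof -
  let ?T = "switch E B (h ` S)" and ?P = "principal_mat K S"
  have P: "?P \<in> carrier_mat n n" by simp
  have hS: "h ` S \<subseteq> E" using S by auto
  have hS_iff: "h j \<in> h ` S \<longleftrightarrow> j \<in> S" if "j < n" for j
    using inj_on_image_mem_iff[OF bij_betw_imp_inj_on[OF h] _ S] that by simp
  show ?thesis
  proof (cases "?T \<in> \<B>")
    case False
    obtain D where D: "D \<in> \<C>" "supp E D \<subseteq> ?T"
      using circuit_in_nonbasis[OF transversal_switch[OF finite_E hS] False] .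
    have off: "D (star (sel B (h j))) = 0" if "j < n" "j \<notin> S" for j
      by (rule zero_outside_supp[OF D(2)]) (use that in \<open>simp_all add: mem_switch_iff[OF hS] hS_iff\<close>)
    have on: "D (sel B (h j)) = 0" if "j \<in> S" for j
      by (rule zero_outside_supp[OF D(2)]) (use that hS in \<open>auto simp: mem_switch_iff[OF hS]\<close>)
    \<comment> \<open>The starred entries of \<open>D\<close> give the kernel vector. It is nonzero
      because otherwise the support of \<open>D\<close> would lie in \<open>B\<close>.\<close>
    let ?v = "vec n (\<lambda>j. D (star (sel B (h j))))"
    have "?v \<noteq> 0\<^sub>v n"
    proof
      assume v0: "?v = 0\<^sub>v n"
      have "\<forall>i<n. D (star (sel B (h i))) = 0"
      proof (intro allI impI)
        fix i assume "i < n"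
        then show "D (star (sel B (h i))) = 0" using arg_cong[OF v0, of "\<lambda>v. v $ i"] by simp
      qed
      then have z: "\<forall>e\<in>E. D (star (sel B e)) = 0" by (simp add: ball_E_iff)
      have "x \<in> B" if "x \<in> ground E" "D x \<noteq> 0" for x
        using that z sel_mem[OF finite_E transversal_basis[OF B]]
        by (cases x rule: ground_cases[of _ _ B]) auto
      then have "supp E D \<subseteq> B" by (auto simp: supp_def)
      then show False using circuit_not_subset_basis[OF D(1) B] by simp
    qed
    moreover have "?P *\<^sub>v ?v = 0\<^sub>v n"
    proof (rule eq_vecI)
      fix i assume i: "i < dim_vec (0\<^sub>v n :: int vec)"
      have "(\<Sum>j\<in>S. K $$ (i, j) * ?v $ j) = (\<Sum>j\<in>S. K $$ (i, j) * D (star (sel B (h j))))"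
        using S by (intro sum.cong) auto
      then show "(?P *\<^sub>v ?v) $ i = 0\<^sub>v n $ i"
        using i off on circuit_expansion_sub[OF D(1) S off, of i]
        by (simp add: principal_mat_mult_vec[OF K_carrier _ _ S] del: index_mult_mat_vec)
    qed simp
    ultimately have "det ?P = 0" using det_0_iff_vec_prod_zero[OF P] vec_carrier by blast
    then show ?thesis using False by simp
  next
    case True
    \<comment> \<open>Fundamental circuits of the basis \<open>?T\<close>. Over \<open>S\<close> the
      roles of \<open>sel B\<close> and its star are exchanged, so their normalization turns into
      unit vectors on \<open>B\<close>.\<close>
    have "\<exists>D\<in>\<C>. (\<forall>f\<in>S. D (sel B (h f)) = (if f = g then 1 else 0)) \<and>
        (\<forall>f. f < n \<longrightarrow> f \<notin> S \<longrightarrow> D (star (sel B (h f))) = 0)" if g: "g \<in> S" for g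
    proof -
      have gn: "g < n" using g S by auto
      obtain C where C: "C \<in> \<C>" "C (star (sel ?T (h g))) = 1"
          "\<And>f. f \<in> E \<Longrightarrow> f \<noteq> h g \<Longrightarrow> C (star (sel ?T f)) = 0"
        using fundamental_circuit[OF True h_mem[OF gn]] by metis
      have "C (sel B (h f)) = (if f = g then 1 else 0)" if "f \<in> S" for f
      proof -
        have "f < n" using that S by auto
        then show ?thesis using C(2) C(3)[of "h f"] that g gn
          by (auto simp: sel_switch[OF hS] h_eq_iff)
      qed
      moreover have "C (star (sel B (h f))) = 0" if "f < n" "f \<notin> S" for f
      proof -
        have "f \<noteq> g" using that g by auto
        then show ?thesis using C(3)[of "h f"] that gn by (simp add: sel_switch[OF hS] h_eq_iff hS_iff)
      qed
      ultimately show ?thesis using C(1) by blast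
    qed
    then obtain D where D: "\<And>g. g \<in> S \<Longrightarrow> D g \<in> \<C>"
        "\<And>g f. g \<in> S \<Longrightarrow> f \<in> S \<Longrightarrow> D g (sel B (h f)) = (if f = g then 1 else 0)"
        "\<And>g f. g \<in> S \<Longrightarrow> f < n \<Longrightarrow> f \<notin> S \<Longrightarrow> D g (star (sel B (h f))) = 0"
      by metis
    \<comment> \<open>The inverse of \<open>?P\<close>: for \<open>g\<close> in \<open>S\<close>,
      column \<open>g\<close> lists the starred entries of \<open>D g\<close>, which vanish outside
      \<open>S\<close>. The other columns match the identity padding.\<close>
    define W where "W = mat n n (\<lambda>(j, g). if g \<in> S then D g (star (sel B (h j))) else if j = g then 1 else 0)"
    have W: "W \<in> carrier_mat n n" by (simp add: W_def)
    have "?P * W = 1\<^sub>m n"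
    proof (rule eq_matI)
      fix i g assume "i < dim_row (1\<^sub>m n :: int mat)" "g < dim_col (1\<^sub>m n :: int mat)"
      then have i: "i < n" and g: "g < n" by simp_all
      have Sn: "j < n" if "j \<in> S" for j using that S by auto
      have colW: "col W g $ j = (if g \<in> S then D g (star (sel B (h j))) else if j = g then 1 else 0)"
        if "j < n" for j using that g by (simp add: W_def)
      have "(?P * W) $$ (i, g) = (?P *\<^sub>v col W g) $ i" using i g W by simp
      also have "\<dots> = (if i \<in> S then \<Sum>j\<in>S. K $$ (i, j) * col W g $ j else col W g $ i)"
        by (rule principal_mat_mult_vec[OF K_carrier _ i S]) (use W g in simp)
      also have "\<dots> = 1\<^sub>m n $$ (i, g)"
      proof (cases "g \<in> S")
        case True
        have "(\<Sum>j\<in>S. K $$ (i, j) * col W g $ j) = (\<Sum>j\<in>S. K $$ (i, j) * D g (star (sel B (h j))))"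
          using True by (intro sum.cong refl) (simp add: colW Sn)
        then show ?thesis
          using i g True D(2,3)[OF True] circuit_expansion_sub[OF D(1)[OF True] S D(3)[OF True] i]
          by (cases "i = g") (simp_all add: colW)
      next
        case False
        have "(\<Sum>j\<in>S. K $$ (i, j) * col W g $ j) = 0"
          using False by (intro sum.neutral) (auto simp: colW Sn)
        then show ?thesis using i g False by (auto simp: colW)
      qed
      finally show "(?P * W) $$ (i, g) = 1\<^sub>m n $$ (i, g)" .
    qed (use W in simp_all)
    \<comment> \<open>Two integers with product 1 are both 1 or both -1, and nonnegativity of the
      minor settles the sign.\<close>
    then have "det ?P * det W = 1" using det_mult[OF P W] by simp
    moreover have "0 \<le> det ?P" by (rule det_principal_mat_nonneg[OF K_carrier S K_skew])
    ultimately have "det ?P = 1" using abs_zmult_eq_1[of "det ?P" "det W"] by simp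
    then show ?thesis using True by simp
  qed
qed

text \<open>As \<open>S\<close> varies, the switched sets run through every transversal once, so the
  sum of the minors, each 0 or 1, counts the bases.\<close>

lemma det_one_plus_K: "det (1\<^sub>m n + K) = int (card \<B>)"
proof -
  have bij: "bij_betw (switch E B \<circ> (`) h) (Pow {0..<n}) {T. transversal E T}"
    using bij_betw_Pow[OF h] bij_betw_switch[OF finite_E] by (rule bij_betw_trans)
  have "bij_betw (switch E B \<circ> (`) h) {S \<in> Pow {0..<n}. (switch E B \<circ> (`) h) S \<in> \<B>} {T \<in> {T. transversal E T}. T \<in> \<B>}"
    using bij by (rule bij_betw_Collect) simp
  moreover have "{T \<in> {T. transversal E T}. T \<in> \<B>} = \<B>" using transversal_basis by blast
  ultimately have "card {S \<in> Pow {0..<n}. (switch E B \<circ> (`) h) S \<in> \<B>} = card \<B>"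
    by (simp add: bij_betw_same_card)
  moreover have "det (1\<^sub>m n + K) = (\<Sum>S\<in>Pow {0..<n}. if (switch E B \<circ> (`) h) S \<in> \<B> then 1 else 0)"
    unfolding det_one_plus[OF K_carrier] by (intro sum.cong) (auto simp: det_principal_mat_K)
  ultimately show ?thesis by (simp add: sum.If_cases Int_def)
qed

section \<open>The lattice of projected circuits in coordinates, and its index\<close>

definition coords :: "('a \<Rightarrow> int) \<Rightarrow> int vec" where
  "coords v = vec n (\<lambda>i. v (h i))"

lemma coords_carrier [simp]: "coords v \<in> carrier_vec n"
  by (simp add: coords_def)

lemma coords_add: "coords (\<lambda>e\<in>E. v e + w e) = coords v + coords w"
  by (rule eq_vecI) (simp_all add: coords_def)

lemma coords_inj:
  assumes "v \<in> carrier (int_vectors E)" "w \<in> carrier (int_vectors E)" "coords v = coords w"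
  shows "v = w"
proof -
  have "v (h i) = w (h i)" if "i < n" for i
    using arg_cong[OF assms(3), of "\<lambda>x. x $ i"] that by (simp add: coords_def)
  then have "\<forall>e\<in>E. v e = w e" by (simp add: ball_E_iff)
  then show ?thesis using assms(1,2) by (auto intro: PiE_ext)
qed

lemma coords_surj:
  assumes "x \<in> carrier_vec n"
  obtains v where "v \<in> carrier (int_vectors E)" "coords v = x"
proof
  let ?v = "\<lambda>e\<in>E. x $ (inv_into {0..<n} h e)"
  show "?v \<in> carrier (int_vectors E)" by simp
  show "coords ?v = x"
    by (rule eq_vecI) (use assms h in \<open>auto simp: coords_def bij_betw_def\<close>)
qed

abbreviation lattice :: "('a \<Rightarrow> int) set" where
  "lattice \<equiv> generate (int_vectors E) (proj E ` \<C>)"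

lemma proj_carrier: "proj E C \<in> carrier (int_vectors E)"
  by (simp add: proj_def)

lemma subgroup_lattice: "subgroup lattice (int_vectors E)"
  by (rule group.generate_is_subgroup) (auto simp: proj_def)

lemma mult_one_plus_K:
  assumes "u \<in> carrier_vec n" "i < n"
  shows "((1\<^sub>m n + K) *\<^sub>v u) $ i = u $ i + (\<Sum>j\<in>{0..<n}. K $$ (i, j) * u $ j)"
proof -
  have "(1\<^sub>m n + K) *\<^sub>v u = u + K *\<^sub>v u"
    using assms(1) by (simp add: add_mult_distrib_mat_vec[of _ n n])
  moreover have "(K *\<^sub>v u) $ i = (\<Sum>j\<in>{0..<n}. K $$ (i, j) * u $ j)"
    using assms K_carrier by (auto simp: scalar_prod_def)
  ultimately show ?thesis using assms by simp
qed

text \<open>If \<open>u\<close> is the starred part of \<open>D\<close>, then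
  \<open>K *\<^sub>v u\<close> is its part on \<open>B\<close>, and \<open>proj\<close> adds the
  two.\<close>

lemma coords_proj:
  assumes "D \<in> \<C>"
  shows "coords (proj E D) = (1\<^sub>m n + K) *\<^sub>v vec n (\<lambda>j. D (star (sel B (h j))))" (is "_ = _ *\<^sub>v ?u")
proof (rule eq_vecI)
  fix i assume "i < dim_vec ((1\<^sub>m n + K) *\<^sub>v ?u)"
  then have i: "i < n" using K_carrier by simp
  have "(\<Sum>j\<in>{0..<n}. K $$ (i, j) * ?u $ j) = D (sel B (h i))"
    unfolding circuit_expansion_K[OF assms i] by (rule sum.cong) auto
  then show "coords (proj E D) $ i = ((1\<^sub>m n + K) *\<^sub>v ?u) $ i"
    using i by (simp add: mult_one_plus_K proj_apply[of _ _ _ B] coords_def del: index_mult_mat_vec)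
qed (use K_carrier in \<open>simp add: coords_def\<close>)

text \<open>Forwards, the image of \<open>1 + K\<close> contains the generators and is closed under
  the group operations. Backwards, the columns of \<open>1 + K\<close> are the coordinates of
  projected fundamental circuits.\<close>

lemma mem_lattice_iff:
  assumes v: "v \<in> carrier (int_vectors E)"
  shows "v \<in> lattice \<longleftrightarrow> (\<exists>u\<in>carrier_vec n. coords v = (1\<^sub>m n + K) *\<^sub>v u)"
proof
  assume "v \<in> lattice"
  then show "\<exists>u\<in>carrier_vec n. coords v = (1\<^sub>m n + K) *\<^sub>v u"
  proof (induction rule: generate.induct)
    case one
    have "coords (\<lambda>i\<in>E. 0) = (1\<^sub>m n + K) *\<^sub>v 0\<^sub>v n"
      by (rule eq_vecI) (simp_all add: mult_one_plus_K coords_def del: index_mult_mat_vec)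
    then show ?case by (metis one_int_vectors zero_carrier_vec)
  next
    case (incl w)
    then show ?case using coords_proj by auto
  next
    case (inv w)
    then obtain C where C: "C \<in> \<C>" "w = proj E C" by blast
    \<comment> \<open>The inverse of a generator is again a generator, since \<open>\<C>\<close> is
      closed under negation.\<close>
    have "inv\<^bsub>int_vectors E\<^esub> w = proj E (\<lambda>x\<in>ground E. - C x)"
      unfolding C(2) using proj_carrier[of C] by (simp add: proj_def cong: restrict_cong)
    then show ?case using coords_proj[OF uminus_circuit[OF C(1)]] by auto
  next
    case (eng w1 w2)
    then obtain u1 u2 where u: "u1 \<in> carrier_vec n" "coords w1 = (1\<^sub>m n + K) *\<^sub>v u1"
      "u2 \<in> carrier_vec n" "coords w2 = (1\<^sub>m n + K) *\<^sub>v u2" by blast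
    then have "coords (w1 \<otimes>\<^bsub>int_vectors E\<^esub> w2) = (1\<^sub>m n + K) *\<^sub>v (u1 + u2)"
      by (simp add: coords_add mult_add_distrib_mat_vec[of _ n n])
    then show ?case using u(1,3) add_carrier_vec by blast
  qed
next
  assume "\<exists>u\<in>carrier_vec n. coords v = (1\<^sub>m n + K) *\<^sub>v u"
  then obtain u where u: "u \<in> carrier_vec n" "coords v = (1\<^sub>m n + K) *\<^sub>v u" by blast
  let ?w = "\<lambda>e\<in>E. \<Sum>j\<in>{0..<n}. u $ j * proj E (fund (h j)) e"
  have w: "?w \<in> lattice"
    by (rule sum_mem_subgroup_int_vectors[OF subgroup_lattice]) (auto intro!: generate.incl fund)
  have "coords ?w = (1\<^sub>m n + K) *\<^sub>v u"
  proof (rule eq_vecI)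
    fix i assume "i < dim_vec ((1\<^sub>m n + K) *\<^sub>v u)"
    then have i: "i < n" using K_carrier by simp
    have "(\<Sum>j\<in>{0..<n}. u $ j * proj E (fund (h j)) (h i)) =
        (\<Sum>j\<in>{0..<n}. (if i = j then u $ j else 0) + K $$ (i, j) * u $ j)"
      using i by (intro sum.cong)
        (auto simp: proj_apply[of _ _ _ B] fund(2) h_eq_iff K_def algebra_simps)
    also have "\<dots> = ((1\<^sub>m n + K) *\<^sub>v u) $ i"
      using i by (simp add: mult_one_plus_K[OF u(1) i] sum.distrib del: index_mult_mat_vec)
    finally show "coords ?w $ i = ((1\<^sub>m n + K) *\<^sub>v u) $ i"
      using i by (simp add: coords_def del: index_mult_mat_vec)
  qed (use K_carrier in \<open>simp add: coords_def\<close>)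
  then have "v = ?w" using u(2) v by (intro coords_inj) auto
  then show "v \<in> lattice" using w by simp
qed

text \<open>Matches cosets in the group with the relation that defines
  \<open>residue_system\<close>.\<close>

lemma mem_coset_iff:
  assumes v: "v \<in> carrier (int_vectors E)" and r: "r \<in> carrier (int_vectors E)"
  shows "v \<in> lattice #>\<^bsub>int_vectors E\<^esub> r \<longleftrightarrow>
    (\<exists>u\<in>carrier_vec n. coords v = coords r + (1\<^sub>m n + K) *\<^sub>v u)"
proof
  assume "v \<in> lattice #>\<^bsub>int_vectors E\<^esub> r"
  then obtain l where l: "l \<in> lattice" "v = l \<otimes>\<^bsub>int_vectors E\<^esub> r" by (auto simp: r_coset_def)
  then have "l \<in> carrier (int_vectors E)" using subgroup.subset[OF subgroup_lattice] by blast
  then obtain u where "u \<in> carrier_vec n" "coords l = (1\<^sub>m n + K) *\<^sub>v u"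
    using l(1) mem_lattice_iff by blast
  moreover have "coords v = coords r + coords l"
    using l(2) by (simp add: coords_add comm_add_vec[of _ n])
  ultimately show "\<exists>u\<in>carrier_vec n. coords v = coords r + (1\<^sub>m n + K) *\<^sub>v u" by auto
next
  assume "\<exists>u\<in>carrier_vec n. coords v = coords r + (1\<^sub>m n + K) *\<^sub>v u"
  then obtain u where u: "u \<in> carrier_vec n" "coords v = coords r + (1\<^sub>m n + K) *\<^sub>v u" by blast
  have Ku: "(1\<^sub>m n + K) *\<^sub>v u \<in> carrier_vec n"
    by (rule mult_mat_vec_carrier[OF _ u(1)]) simp
  obtain l where l: "l \<in> carrier (int_vectors E)" "coords l = (1\<^sub>m n + K) *\<^sub>v u"
    using coords_surj[OF Ku] .
  then have "l \<in> lattice" using mem_lattice_iff u(1) by blast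
  moreover have "v = l \<otimes>\<^bsub>int_vectors E\<^esub> r"
    by (rule coords_inj) (use v u(2) l Ku in \<open>simp_all add: coords_add comm_add_vec[of _ n]\<close>)
  ultimately show "v \<in> lattice #>\<^bsub>int_vectors E\<^esub> r" by (auto simp: r_coset_def)
qed

lemma card_cosets_lattice:
  "finite (rcosets\<^bsub>int_vectors E\<^esub> lattice)" "card (rcosets\<^bsub>int_vectors E\<^esub> lattice) = card \<B>"
proof -
  have M: "1\<^sub>m n + K \<in> carrier_mat n n" by simp
  have "finite \<B>"
    by (rule finite_subset[of _ "Pow (ground E)"])
      (use transversal_basis finite_ground[OF finite_E] in \<open>auto simp: transversal_def\<close>)
  \<comment> \<open>Existence of a basis is what makes the determinant nonzero, and hence the index
    finite.\<close>
  then have "card \<B> \<noteq> 0" using bases_nonempty by simp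
  then have "det (1\<^sub>m n + K) \<noteq> 0" by (simp add: det_one_plus_K)
  then obtain R where R: "residue_system (1\<^sub>m n + K) R" "card R = card \<B>"
    using exists_residue_system[OF M] det_one_plus_K by auto
  define R' where "R' = {v \<in> carrier (int_vectors E). coords v \<in> R}"
  have RC: "R \<subseteq> carrier_vec n" and fin: "finite R" using R(1) by (auto simp: residue_system_def)
  have "bij_betw coords R' R"
  proof (rule bij_betw_imageI)
    show "inj_on coords R'" by (rule inj_onI) (use coords_inj in \<open>auto simp: R'_def\<close>)
    show "coords ` R' = R" using RC coords_surj unfolding R'_def by blast
  qed
  then have R': "card R' = card \<B>" "finite R'" using R(2) fin bij_betw_same_card bij_betw_finite by metis+
  have "bij_betw ((#>\<^bsub>int_vectors E\<^esub>) lattice) R' (rcosets\<^bsub>int_vectors E\<^esub> lattice)"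
  proof (rule group.bij_betw_rcosets[OF group_int_vectors subgroup_lattice])
    show "R' \<subseteq> carrier (int_vectors E)" by (auto simp: R'_def)
    fix v assume v: "v \<in> carrier (int_vectors E)"
    have "\<exists>!r. r \<in> R \<and> (\<exists>u\<in>carrier_vec n. coords v = r + (1\<^sub>m n + K) *\<^sub>v u)"
      using R(1) M unfolding residue_system_def by simp
    then obtain r where r: "r \<in> R" "\<exists>u\<in>carrier_vec n. coords v = r + (1\<^sub>m n + K) *\<^sub>v u"
      and uniq: "\<And>r'. r' \<in> R \<Longrightarrow> \<exists>u\<in>carrier_vec n. coords v = r' + (1\<^sub>m n + K) *\<^sub>v u \<Longrightarrow> r' = r" by blast
    obtain w where w: "w \<in> carrier (int_vectors E)" "coords w = r" using coords_surj r(1) RC by blast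
    show "\<exists>!r. r \<in> R' \<and> v \<in> lattice #>\<^bsub>int_vectors E\<^esub> r"
    proof (rule ex1I[of _ w])
      show "w \<in> R' \<and> v \<in> lattice #>\<^bsub>int_vectors E\<^esub> w"
        using w r mem_coset_iff[OF v w(1)] by (simp add: R'_def)
      fix w' assume w': "w' \<in> R' \<and> v \<in> lattice #>\<^bsub>int_vectors E\<^esub> w'"
      then have "coords w' = r" using uniq mem_coset_iff[OF v] unfolding R'_def by blast
      then show "w' = w" using w w' coords_inj unfolding R'_def by blast
    qed
  qed
  then show "finite (rcosets\<^bsub>int_vectors E\<^esub> lattice)" "card (rcosets\<^bsub>int_vectors E\<^esub> lattice) = card \<B>"
    using R' bij_betw_finite bij_betw_same_card by metis+
qed

end

theorem proposition3p2:
  fixes E :: "'a set"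
    and \<B> :: "('a + 'a) set set"
    and \<C> :: "('a + 'a \<Rightarrow> int) set"
  assumes "orthogonal_matroid E \<B>"
    and "regular_orthogonal_representation E \<B> \<C>"
  shows "finite (carrier (Jac E \<C>)) \<and> order (Jac E \<C>) = card \<B>"
proof -
  interpret regular_representation E \<B> \<C> using assms by unfold_locales
  obtain B where B: "B \<in> \<B>" using bases_nonempty by blast
  obtain h where h: "bij_betw h {0..<card E} E" using ex_bij_betw_nat_finite[OF finite_E] by blast
  interpret representation_at_basis E \<B> \<C> B "card E" h using B h by unfold_locales
  show ?thesis using card_cosets_lattice by (simp add: Jac_def FactGroup_def Coset.order_def)
qed

end
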